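(* Let $P$ be a finite set of atomic propositions, $T>0$, $\mathbb{T}=[0,T)$, let $x:\mathbb{T}\to 2^P$ be a piecewise-constant càdlàg signal, and let $\varphi$ be an MTL formula in positive normal form whose temporal operators carry closed intervals $[a,b]$, $a,b\in\mathbb{N}$, $a\le b$. Then for every $i\in\mathbb{T}$: if $\llbracket x,\varphi\rrbracket(i)>0$ then $(x,i)\models\varphi$; and if $(x,i)\not\models\varphi$ then $\llbracket x,\varphi\rrbracket(i)=0$.
   Context: Càdlàg piecewise constant: each $x_p$ ($x_p(t)=1$ iff $p\in x(t)$, else $0$) changes value finitely often, is right-continuous and has left limits everywhere. Positive normal form: $\varphi::=p\mid\neg p\mid\varphi\vee\psi\mid\varphi\wedge\psi\mid F_I\varphi\mid G_I\varphi\mid P_I\varphi\mid H_I\varphi\mid\varphi U_I\psi\mid\varphi S_I\psi$. Classical semantics $\models$: $p$ iff $x_p(i)=1$; $\neg p,\vee,\wedge$ as usual; $F_I\varphi$: $\exists j\in(i+I)\cap\mathbb{T}$ with $(x,j)\models\varphi$; $G_I\varphi$: $\forall j\in(i+I)\cap\mathbb{T}$; $P_I\varphi$, $H_I\varphi$: same with $i-I$; $\varphi U_I\psi$: $\exists j\in(i+I)\cap\mathbb{T}$ with $(x,j)\models\psi$ and $(x,k)\models\varphi$ for all real $k\in(i,j)$; $\varphi S_I\psi$: $\exists j\in(i-I)\cap\mathbb{T}$ with $(x,j)\models\psi$ and $(x,k)\models\varphi$ for all $k\in(j,i)$. Quantitative semantics: for $I=[a,b]$ with $a<b$, $w^+_I(t)=\frac1{b-a}$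 if $t\in[-b,-a]$ and $0$ otherwise, $w^-_I(t)=\frac1{b-a}$ if $t\in[a,b]$ and $0$ otherwise; for $I=[a,a]$ the windows are Dirac deltas, so that $\int_{\mathbb{T}} f(j)w^+_{[a,a]}(i-j)\,dj=f(i+a)$ and $\int_{\mathbb{T}}f(j)w^-_{[a,a]}(i-j)\,dj=f(i-a)$ (taken as $0$ if the point lies outside $\mathbb{T}$). Then $\llbracket x,p\rrbracket(i)=x_p(i)$; $\llbracket x,\neg p\rrbracket(i)=1-x_p(i)$; $\vee\mapsto\max$, $\wedge\mapsto\min$ pointwise; $\llbracket x,F_I\varphi\rrbracket(i)=\int_{\mathbb{T}}\llbracket x,\varphi\rrbracket(j)\,w^+_I(i-j)\,dj$; $\llbracket x,P_I\varphi\rrbracket(i)=\int_{\mathbb{T}}\llbracket x,\varphi\rrbracket(j)\,w^-_I(i-j)\,dj$; $\llbracket x,G_I\varphi\rrbracket(i)=\inf_{j\in(i+I)\cap\mathbb{T}}\llbracket x,\varphi\rrbracket(j)$; $\llbracket x,H_I\varphi\rrbracket(i)=\inf_{j\in(i-I)\cap\mathbb{T}}\llbracket x,\varphi\rrbracket(j)$ (infimum over the empty set is $1$; $G_{(0,j)}$, $H_{(0,j)}$ use the open interval $(0,j)$ in the same way); $\llbracket x,\varphi U_I\psi\rrbracket(i)=\frac1{b-a}\int_a^b\llbracket x,G_{(0,j)}\varphi\rrbracket(i)\cdot\llbracket x,F_{[j,j]}\psi\rrbracket(i)\,dj$ and $\llbracket x,\varphi S_I\psi\rrbracket(i)=\frac1{b-a}\int_a^b\llbracket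 x,H_{(0,j)}\varphi\rrbracket(i)\cdot\llbracket x,P_{[j,j]}\psi\rrbracket(i)\,dj$ for $a<b$, and these two values are $0$ when $a=b$. *)

theory Defs
  imports "HOL-Analysis.Analysis"
begin

text \<open>MTL formulas in positive normal form. A temporal operator with arguments \<open>a b\<close> carries the
  closed interval \<open>[a, b]\<close>.\<close>

datatype (atoms: 'p) mtl =
    Atom 'p
  | NegAtom 'p
  | Or "'p mtl" "'p mtl"
  | And "'p mtl" "'p mtl"
  | Eventually nat nat "'p mtl"
  | Globally nat nat "'p mtl"
  | Previously nat nat "'p mtl"
  | Historically nat nat "'p mtl"
  | Until nat nat "'p mtl" "'p mtl"
  | Since nat nat "'p mtl" "'p mtl"

primrec proper_intervals :: "'p mtl \<Rightarrow> bool" where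
  "proper_intervals (Atom p) = True"
| "proper_intervals (NegAtom p) = True"
| "proper_intervals (Or \<phi> \<psi>) = (proper_intervals \<phi> \<and> proper_intervals \<psi>)"
| "proper_intervals (And \<phi> \<psi>) = (proper_intervals \<phi> \<and> proper_intervals \<psi>)"
| "proper_intervals (Eventually a b \<phi>) = (a \<le> b \<and> proper_intervals \<phi>)"
| "proper_intervals (Globally a b \<phi>) = (a \<le> b \<and> proper_intervals \<phi>)"
| "proper_intervals (Previously a b \<phi>) = (a \<le> b \<and> proper_intervals \<phi>)"
| "proper_intervals (Historically a b \<phi>) = (a \<le> b \<and> proper_intervals \<phi>)"
| "proper_intervals (Until a b \<phi> \<psi>) = (a \<le> b \<and> proper_intervals \<phi> \<and> proper_intervals \<psi>)"
| "proper_intervals (Since a b \<phi> \<psi>) = (a \<le> b \<and> proper_intervals \<phi> \<and> proper_intervals \<psi>)"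

text \<open>Signals on the time domain \<open>[0, T)\<close> are total functions on the reals; their values outside
  \<open>[0, T)\<close> do not influence either semantics at times in \<open>[0, T)\<close>.\<close>

definition component :: "(real \<Rightarrow> 'p set) \<Rightarrow> 'p \<Rightarrow> real \<Rightarrow> real" where
  "component x p t = (if p \<in> x t then 1 else 0)"

definition finitely_many_changes :: "real \<Rightarrow> (real \<Rightarrow> real) \<Rightarrow> bool" where
  "finitely_many_changes T f \<longleftrightarrow>
     (\<exists>D. finite D \<and> (\<forall>s t. 0 \<le> s \<and> s \<le> t \<and> t < T \<and> {s..t} \<inter> D = {} \<longrightarrow> f s = f t))"

definition cadlag_on :: "real \<Rightarrow> (real \<Rightarrow> real) \<Rightarrow> bool" where
  "cadlag_on T f \<longleftrightarrow>
     (\<forall>t\<in>{0..<T}. continuous (at_right t) f) \<and>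
     (\<forall>t\<in>{0<..<T}. \<exists>l. (f \<longlongrightarrow> l) (at_left t))"

definition pc_cadlag_signal :: "'p set \<Rightarrow> real \<Rightarrow> (real \<Rightarrow> 'p set) \<Rightarrow> bool" where
  "pc_cadlag_signal P T x \<longleftrightarrow>
     (\<forall>t\<in>{0..<T}. x t \<subseteq> P) \<and>
     (\<forall>p\<in>P. finitely_many_changes T (component x p) \<and> cadlag_on T (component x p))"

definition future :: "real \<Rightarrow> real \<Rightarrow> real set \<Rightarrow> real set" where
  "future T i I = (\<lambda>s. i + s) ` I \<inter> {0..<T}"

definition past :: "real \<Rightarrow> real \<Rightarrow> real set \<Rightarrow> real set" where
  "past T i I = (\<lambda>s. i - s) ` I \<inter> {0..<T}"

primrec sat :: "real \<Rightarrow> (real \<Rightarrow> 'p set) \<Rightarrow> 'p mtl \<Rightarrow> real \<Rightarrow> bool" where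
  "sat T x (Atom p) i = (component x p i = 1)"
| "sat T x (NegAtom p) i = (\<not> component x p i = 1)"
| "sat T x (Or \<phi> \<psi>) i = (sat T x \<phi> i \<or> sat T x \<psi> i)"
| "sat T x (And \<phi> \<psi>) i = (sat T x \<phi> i \<and> sat T x \<psi> i)"
| "sat T x (Eventually a b \<phi>) i = (\<exists>j\<in>future T i {real a..real b}. sat T x \<phi> j)"
| "sat T x (Globally a b \<phi>) i = (\<forall>j\<in>future T i {real a..real b}. sat T x \<phi> j)"
| "sat T x (Previously a b \<phi>) i = (\<exists>j\<in>past T i {real a..real b}. sat T x \<phi> j)"
| "sat T x (Historically a b \<phi>) i = (\<forall>j\<in>past T i {real a..real b}. sat T x \<phi> j)"
| "sat T x (Until a b \<phi> \<psi>) i =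
     (\<exists>j\<in>future T i {real a..real b}. sat T x \<psi> j \<and> (\<forall>k\<in>{i<..<j}. sat T x \<phi> k))"
| "sat T x (Since a b \<phi> \<psi>) i =
     (\<exists>j\<in>past T i {real a..real b}. sat T x \<psi> j \<and> (\<forall>k\<in>{j<..<i}. sat T x \<phi> k))"

text \<open>Windows for \<open>a < b\<close>. For \<open>a = b\<close> the window is a Dirac delta, which \<open>q_eventually\<close> and
  \<open>q_previously\<close> render by point evaluation.\<close>

definition w_plus :: "real \<Rightarrow> real \<Rightarrow> real \<Rightarrow> real" where
  "w_plus a b t = (if t \<in> {-b..-a} then 1 / (b - a) else 0)"

definition w_minus :: "real \<Rightarrow> real \<Rightarrow> real \<Rightarrow> real" where
  "w_minus a b t = (if t \<in> {a..b} then 1 / (b - a) else 0)"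

definition q_eventually :: "real \<Rightarrow> real \<Rightarrow> real \<Rightarrow> (real \<Rightarrow> real) \<Rightarrow> real \<Rightarrow> real" where
  "q_eventually T a b f i =
     (if a < b then (LINT j:{0..<T}|lborel. f j * w_plus a b (i - j))
      else if i + a \<in> {0..<T} then f (i + a) else 0)"

definition q_previously :: "real \<Rightarrow> real \<Rightarrow> real \<Rightarrow> (real \<Rightarrow> real) \<Rightarrow> real \<Rightarrow> real" where
  "q_previously T a b f i =
     (if a < b then (LINT j:{0..<T}|lborel. f j * w_minus a b (i - j))
      else if i - a \<in> {0..<T} then f (i - a) else 0)"

definition q_inf :: "real set \<Rightarrow> (real \<Rightarrow> real) \<Rightarrow> real" where
  "q_inf J f = (if J = {} then 1 else (INF j\<in>J. f j))"

definition q_globally :: "real \<Rightarrow> real set \<Rightarrow> (real \<Rightarrow> real) \<Rightarrow> real \<Rightarrow> real" where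
  "q_globally T I f i = q_inf (future T i I) f"

definition q_historically :: "real \<Rightarrow> real set \<Rightarrow> (real \<Rightarrow> real) \<Rightarrow> real \<Rightarrow> real" where
  "q_historically T I f i = q_inf (past T i I) f"

definition q_until ::
  "real \<Rightarrow> real \<Rightarrow> real \<Rightarrow> (real \<Rightarrow> real) \<Rightarrow> (real \<Rightarrow> real) \<Rightarrow> real \<Rightarrow> real" where
  "q_until T a b f g i =
     (if a < b
      then 1 / (b - a) *
        (LINT j:{a..b}|lborel. q_globally T {0<..<j} f i * q_eventually T j j g i)
      else 0)"

definition q_since ::
  "real \<Rightarrow> real \<Rightarrow> real \<Rightarrow> (real \<Rightarrow> real) \<Rightarrow> (real \<Rightarrow> real) \<Rightarrow> real \<Rightarrow> real" where
  "q_since T a b f g i =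
     (if a < b
      then 1 / (b - a) *
        (LINT j:{a..b}|lborel. q_historically T {0<..<j} f i * q_previously T j j g i)
      else 0)"

primrec qsem :: "real \<Rightarrow> (real \<Rightarrow> 'p set) \<Rightarrow> 'p mtl \<Rightarrow> real \<Rightarrow> real" where
  "qsem T x (Atom p) = (\<lambda>i. component x p i)"
| "qsem T x (NegAtom p) = (\<lambda>i. 1 - component x p i)"
| "qsem T x (Or \<phi> \<psi>) = (\<lambda>i. max (qsem T x \<phi> i) (qsem T x \<psi> i))"
| "qsem T x (And \<phi> \<psi>) = (\<lambda>i. min (qsem T x \<phi> i) (qsem T x \<psi> i))"
| "qsem T x (Eventually a b \<phi>) = q_eventually T (real a) (real b) (qsem T x \<phi>)"
| "qsem T x (Globally a b \<phi>) = q_globally T {real a..real b} (qsem T x \<phi>)"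
| "qsem T x (Previously a b \<phi>) = q_previously T (real a) (real b) (qsem T x \<phi>)"
| "qsem T x (Historically a b \<phi>) = q_historically T {real a..real b} (qsem T x \<phi>)"
| "qsem T x (Until a b \<phi> \<psi>) = q_until T (real a) (real b) (qsem T x \<phi>) (qsem T x \<psi>)"
| "qsem T x (Since a b \<phi> \<psi>) = q_since T (real a) (real b) (qsem T x \<phi>) (qsem T x \<psi>)"

end

theory Submission
  imports Defs
begin

text \<open>The value of a formula certifies the formula: it is nonnegative, and zero where the formula
  fails. This relation is preserved by all the operators, because the arithmetic of the quantitative
  semantics mirrors the logic of the classical one: \<open>max\<close> acts as disjunction, \<open>min\<close> and products
  as conjunction, infima as universal and integrals as existential quantification.
  Non-integrable integrands are harmless, since their Bochner integral is \<open>0\<close> by convention.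
  The past operators are future operators with negated offsets.\<close>

definition certifies :: "'a::{zero, order} \<Rightarrow> bool \<Rightarrow> bool" where
  "certifies v Q \<longleftrightarrow> 0 \<le> v \<and> (\<not> Q \<longrightarrow> v = 0)"

lemma certifies_0 [simp]: "certifies 0 Q"
  by (simp add: certifies_def)

lemma certifies_mono: "certifies v Q \<Longrightarrow> (Q \<Longrightarrow> R) \<Longrightarrow> certifies v R"
  by (auto simp: certifies_def)

lemma certifies_max:
  fixes u v :: "'a::{zero, linorder}"
  assumes "certifies u Q" and "certifies v R"
  shows "certifies (max u v) (Q \<or> R)"
  using assms by (auto simp: certifies_def le_max_iff_disj)

lemma certifies_min:
  fixes u v :: "'a::{zero, linorder}"
  assumes "certifies u Q" and "certifies v R"
  shows "certifies (min u v) (Q \<and> R)"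
  using assms by (auto simp: certifies_def min_def)

lemma certifies_mult:
  fixes u v :: "'a::ordered_semiring_0"
  assumes "certifies u Q" and "certifies v R"
  shows "certifies (u * v) (Q \<and> R)"
  using assms by (auto simp: certifies_def)

lemma certifies_set_integral:
  fixes f :: "'a \<Rightarrow> real"
  assumes "\<And>t. t \<in> A \<Longrightarrow> certifies (f t) (Q t)"
  shows "certifies (LINT t:A|M. f t) (\<exists>t\<in>A. Q t)"
proof -
  have "0 \<le> (LINT t:A|M. f t)"
    unfolding set_lebesgue_integral_def
    using assms
    by (intro Bochner_Integration.integral_nonneg) (simp add: certifies_def indicator_def)
  moreover have "(LINT t:A|M. f t) = 0" if "\<not> (\<exists>t\<in>A. Q t)"
  proof -
    have "(\<lambda>t. indicator A t *\<^sub>R f t) = (\<lambda>t. 0)"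
      using assms that by (auto simp: certifies_def indicator_def)
    then show ?thesis
      by (simp add: set_lebesgue_integral_def)
  qed
  ultimately show ?thesis
    by (simp add: certifies_def)
qed

lemma certifies_q_inf:
  assumes "\<And>t. t \<in> J \<Longrightarrow> certifies (f t) (Q t)"
  shows "certifies (q_inf J f) (\<forall>t\<in>J. Q t)"
proof -
  have nonneg: "0 \<le> f t" if "t \<in> J" for t
    using assms that by (simp add: certifies_def)
  then have "0 \<le> q_inf J f"
    by (auto simp: q_inf_def intro: cINF_greatest)
  moreover have "q_inf J f \<le> 0" if "\<not> (\<forall>t\<in>J. Q t)"
  proof -
    obtain t where "t \<in> J" and "f t = 0"
      using \<open>\<not> (\<forall>t\<in>J. Q t)\<close> assms by (auto simp: certifies_def)
    moreover have "bdd_below (f ` J)"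
      using nonneg by (rule bdd_belowI2)
    ultimately show ?thesis
      by (auto simp: q_inf_def dest: cINF_lower)
  qed
  ultimately show ?thesis
    by (auto simp: certifies_def intro: antisym)
qed

lemma mem_future_iff: "j \<in> future T i I \<longleftrightarrow> j - i \<in> I \<and> j \<in> {0..<T}"
  by (force simp: future_def)

lemma past_eq_future_uminus: "past T i I = future T i (uminus ` I)"
  by (simp add: past_def future_def image_image)

lemma q_historically_eq_q_globally: "q_historically T I f i = q_globally T (uminus ` I) f i"
  by (simp add: q_historically_def q_globally_def past_eq_future_uminus)

lemma w_minus_eq_w_plus: "w_minus a b t = w_plus (- b) (- a) t"
  by (auto simp: w_minus_def w_plus_def)

lemma q_previously_eq_q_eventually:
  "a \<le> b \<Longrightarrow> q_previously T a b f i = q_eventually T (- b) (- a) f i"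
  by (simp add: q_previously_def q_eventually_def w_minus_eq_w_plus)

lemma certifies_q_globally:
  assumes "\<And>t. t \<in> {0..<T} \<Longrightarrow> certifies (f t) (Q t)"
  shows "certifies (q_globally T I f i) (\<forall>t\<in>future T i I. Q t)"
  unfolding q_globally_def using assms by (intro certifies_q_inf) (simp add: mem_future_iff)

lemma certifies_q_eventually:
  assumes "a \<le> b" and f: "\<And>t. t \<in> {0..<T} \<Longrightarrow> certifies (f t) (Q t)"
  shows "certifies (q_eventually T a b f i) (\<exists>t\<in>future T i {a..b}. Q t)"
proof (cases "a < b")
  case True
  then have "certifies (w_plus a b (i - t)) (t - i \<in> {a..b})" for t
    by (auto simp: certifies_def w_plus_def)
  then have "certifies (LINT t:{0..<T}|lborel. f t * w_plus a b (i - t))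
      (\<exists>t\<in>{0..<T}. Q t \<and> t - i \<in> {a..b})"
    using f by (intro certifies_set_integral certifies_mult)
  then have "certifies (q_eventually T a b f i) (\<exists>t\<in>{0..<T}. Q t \<and> t - i \<in> {a..b})"
    using True by (simp add: q_eventually_def)
  then show ?thesis
    by (rule certifies_mono) (auto simp: mem_future_iff)
next
  case False
  with \<open>a \<le> b\<close> have "a = b" by simp
  show ?thesis
  proof (cases "i + a \<in> {0..<T}")
    case True
    then have "i + a \<in> future T i {a..b}"
      using \<open>a = b\<close> by (simp add: mem_future_iff)
    then have "certifies (f (i + a)) (\<exists>t\<in>future T i {a..b}. Q t)"
      using f[OF True] by (blast intro: certifies_mono)
    with True \<open>a = b\<close> show ?thesis
      by (simp add: q_eventually_def)
  qed (use \<open>a = b\<close> in \<open>auto simp: q_eventually_def\<close>)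
qed

lemma certifies_integral_globally_eventually:
  assumes "\<And>t. t \<in> {0..<T} \<Longrightarrow> certifies (f t) (Q t)"
    and "\<And>t. t \<in> {0..<T} \<Longrightarrow> certifies (g t) (R t)"
  shows "certifies (LINT j:A|M. q_globally T (K j) f i * q_eventually T (d j) (d j) g i)
    (\<exists>j\<in>A. (\<forall>t\<in>future T i (K j). Q t) \<and> (\<exists>t\<in>future T i {d j..d j}. R t))"
  using assms
  by (intro certifies_set_integral certifies_mult certifies_q_globally certifies_q_eventually) auto

lemma certifies_q_until:
  assumes "0 \<le> i"
    and "\<And>t. t \<in> {0..<T} \<Longrightarrow> certifies (f t) (Q t)"
    and "\<And>t. t \<in> {0..<T} \<Longrightarrow> certifies (g t) (R t)"
  shows "certifies (q_until T a b f g i) (\<exists>j\<in>future T i {a..b}. R j \<and> (\<forall>k\<in>{i<..<j}. Q k))"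
proof -
  have "certifies (LINT j:{a..b}|lborel. q_globally T {0<..<j} f i * q_eventually T j j g i)
      (\<exists>d\<in>{a..b}. (\<forall>t\<in>future T i {0<..<d}. Q t) \<and> (\<exists>t\<in>future T i {d..d}. R t))"
      (is "certifies _ ?visit")
    using assms(2,3) by (rule certifies_integral_globally_eventually)
  then have "certifies (q_until T a b f g i) ?visit"
    by (simp add: q_until_def certifies_def)
  then show ?thesis
    by (rule certifies_mono) (use \<open>0 \<le> i\<close> in \<open>force simp: mem_future_iff\<close>)
qed

lemma certifies_q_since:
  assumes "i < T"
    and "\<And>t. t \<in> {0..<T} \<Longrightarrow> certifies (f t) (Q t)"
    and "\<And>t. t \<in> {0..<T} \<Longrightarrow> certifies (g t) (R t)"
  shows "certifies (q_since T a b f g i) (\<exists>j\<in>past T i {a..b}. R j \<and> (\<forall>k\<in>{j<..<i}. Q k))"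
proof -
  have "certifies
      (LINT j:{a..b}|lborel. q_globally T {- j<..<0} f i * q_eventually T (- j) (- j) g i)
      (\<exists>d\<in>{a..b}. (\<forall>t\<in>future T i {- d<..<0}. Q t) \<and> (\<exists>t\<in>future T i {- d..- d}. R t))"
      (is "certifies _ ?visit")
    using assms(2,3) by (rule certifies_integral_globally_eventually)
  then have "certifies (q_since T a b f g i) ?visit"
    by (simp add: q_since_def q_historically_eq_q_globally q_previously_eq_q_eventually
        certifies_def)
  then show ?thesis
    by (rule certifies_mono)
      (use \<open>i < T\<close> in \<open>force simp: past_eq_future_uminus mem_future_iff\<close>)
qed

lemma certifies_qsem_sat:
  assumes "proper_intervals \<phi>" and "i \<in> {0..<T}"
  shows "certifies (qsem T x \<phi> i) (sat T x \<phi> i)"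
  using assms
proof (induction \<phi> arbitrary: i)
  case (Atom p)
  show ?case by (simp add: certifies_def component_def)
next
  case (NegAtom p)
  show ?case by (simp add: certifies_def component_def)
next
  case (Or \<phi> \<psi>)
  then show ?case by (simp add: certifies_max)
next
  case (And \<phi> \<psi>)
  then show ?case by (simp add: certifies_min)
next
  case (Eventually a b \<phi>)
  then show ?case by (auto intro!: certifies_q_eventually)
next
  case (Globally a b \<phi>)
  then show ?case by (auto intro!: certifies_q_globally)
next
  case (Previously a b \<phi>)
  then show ?case
    by (auto simp: q_previously_eq_q_eventually past_eq_future_uminus
        intro!: certifies_q_eventually)
next
  case (Historically a b \<phi>)
  then show ?case
    by (auto simp: q_historically_eq_q_globally past_eq_future_uminus intro!: certifies_q_globally)
next
  case (Until a b \<phi> \<psi>)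
  then show ?case by (auto intro!: certifies_q_until)
next
  case (Since a b \<phi> \<psi>)
  then show ?case by (auto intro!: certifies_q_since)
qed

theorem theorem4:
  fixes P :: "'p set" and T :: real and x :: "real \<Rightarrow> 'p set" and \<phi> :: "'p mtl"
  assumes "finite P"
    and "T > 0"
    and "pc_cadlag_signal P T x"
    and "atoms \<phi> \<subseteq> P"
    and "proper_intervals \<phi>"
  shows "\<forall>i\<in>{0..<T}. (qsem T x \<phi> i > 0 \<longrightarrow> sat T x \<phi> i) \<and>
                      (\<not> sat T x \<phi> i \<longrightarrow> qsem T x \<phi> i = 0)"
proof
  fix i
  assume "i \<in> {0..<T}"
  with assms(5) have "certifies (qsem T x \<phi> i) (sat T x \<phi> i)"
    by (rule certifies_qsem_sat)
  then show "(qsem T x \<phi> i > 0 \<longrightarrow> sat T x \<phi> i) \<and> (\<not> sat T x \<phi> i \<longrightarrow> qsem T x \<phi> i = 0)"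
    by (auto simp: certifies_def)
qed

end
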